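(* Let $G$ be a connected graph of order $n\geqslant 3$ with maximum degree $\Delta(G)$, and let $k\geqslant 2$ be an integer. Then $$D(G^{\frac{1}{k}})\leqslant \min\Big\{s : 2^k+\sum_{j=3}^{s} j^{k-1}\geqslant \Delta(G)\Big\}.$$
   Context: Graphs are finite and simple. The $k$-subdivision $G^{\frac{1}{k}}$ is obtained by replacing each edge $uv$ of $G$ by a path of length $k$ between $u$ and $v$ with $k-1$ new internal vertices. The distinguishing number $D(H)$ is the least $d$ such that some labeling $V(H)\to\{1,\dots,d\}$ is preserved by no non-trivial automorphism of $H$. The sum $\sum_{j=3}^{s}$ is empty (equal to $0$) when $s<3$.
   Formalization: The minimum is taken over integers s ≥ 2; with s = 1 admitted the bound would be 1 whenever Δ(G) ≤ 2^k, which fails for G = P_3, k = 2, where the subdivision P_5 has distinguishing number 2. *)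

theory Defs
  imports "Graph_Theory.Graph_Theory" "HOL-Library.Multiset"
begin

text \<open>
  Following the library, a finite simple graph is a \<open>pair_graph\<close>: a finite, loop-free,
  symmetric relation on a finite vertex set. Each undirected edge is represented by its two
  opposite arcs, so that the degree of a vertex is its out-degree.
\<close>

definition max_degree :: "'a pair_pre_digraph \<Rightarrow> nat" where
  "max_degree G = Max ((\<lambda>v. out_degree (with_proj G) v) ` pverts G)"

definition automorphism :: "'a pair_pre_digraph \<Rightarrow> ('a \<Rightarrow> 'a) \<Rightarrow> bool" where
  "automorphism G f \<longleftrightarrow> bij_betw f (pverts G) (pverts G) \<and>
     (\<forall>u\<in>pverts G. \<forall>v\<in>pverts G. (u, v) \<in> parcs G \<longleftrightarrow> (f u, f v) \<in> parcs G)"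

text \<open>
  \<open>f\<close> is only constrained on the vertex set, so being trivial means being the identity there.
\<close>

definition distinguishing_labeling :: "'a pair_pre_digraph \<Rightarrow> nat \<Rightarrow> ('a \<Rightarrow> nat) \<Rightarrow> bool" where
  "distinguishing_labeling G d c \<longleftrightarrow> c ` pverts G \<subseteq> {1..d} \<and>
     (\<forall>f. automorphism G f \<and> (\<forall>v\<in>pverts G. c (f v) = c v) \<longrightarrow> (\<forall>v\<in>pverts G. f v = v))"

definition distinguishing_number :: "'a pair_pre_digraph \<Rightarrow> nat" where
  "distinguishing_number G = (LEAST d. \<exists>c. distinguishing_labeling G d c)"

text \<open>
  The point at distance \<open>i\<close> from \<open>u\<close> on the path of length \<open>k\<close> that replaces the edge \<open>uv\<close> is
  encoded by the multiset with \<open>k - i\<close> copies of \<open>u\<close> and \<open>i\<close> copies of \<open>v\<close>. Counting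
  from \<open>v\<close> instead gives the same multiset, so both arcs of an edge describe one path; distinct
  points of the subdivided graph get distinct multisets, and \<open>i = 0\<close> and \<open>i = k\<close> give the
  original vertices \<open>u\<close> and \<open>v\<close> (as \<open>k\<close> copies of themselves).
\<close>

definition path_point :: "nat \<Rightarrow> 'a \<Rightarrow> 'a \<Rightarrow> nat \<Rightarrow> 'a multiset" where
  "path_point k u v i = replicate_mset (k - i) u + replicate_mset i v"

definition k_subdivision :: "nat \<Rightarrow> 'a pair_pre_digraph \<Rightarrow> 'a multiset pair_pre_digraph" where
  "k_subdivision k G = \<lparr>
     pverts = replicate_mset k ` pverts G
       \<union> {path_point k u v i | u v i. (u, v) \<in> parcs G \<and> 0 < i \<and> i < k},
     parcs = {(path_point k u v i, path_point k u v (Suc i)) | u v i. (u, v) \<in> parcs G \<and> i < k}\<rparr>"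

lemma path_point_0 [simp]: "path_point k u v 0 = replicate_mset k u"
  and path_point_k [simp]: "path_point k u v k = replicate_mset k v"
  by (simp_all add: path_point_def)

lemma path_point_rev: "i \<le> k \<Longrightarrow> path_point k v u (k - i) = path_point k u v i"
  by (simp add: path_point_def)

lemma count_path_point:
  "u \<noteq> v \<Longrightarrow> count (path_point k u v i) x = (if x = u then k - i else if x = v then i else 0)"
  by (auto simp: path_point_def)

lemma path_point_eq_iff:
  assumes "u \<noteq> v" "u' \<noteq> v'" "0 < i" "i < k" "0 < j" "j < k"
  shows "path_point k u v i = path_point k u' v' j \<longleftrightarrow>
    (u' = u \<and> v' = v \<and> j = i) \<or> (u' = v \<and> v' = u \<and> j = k - i)"
proof
  assume eq: "path_point k u v i = path_point k u' v' j"
  have "set_mset (path_point k u v i) = {u, v}" "set_mset (path_point k u' v' j) = {u', v'}"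
    using assms by (auto simp: path_point_def)
  with eq have "{u, v} = {u', v'}" by simp
  then consider "u' = u" "v' = v" | "u' = v" "v' = u" by (auto simp: doubleton_eq_iff)
  then show "(u' = u \<and> v' = v \<and> j = i) \<or> (u' = v \<and> v' = u \<and> j = k - i)"
  proof cases
    case 1
    have "count (path_point k u v i) v = count (path_point k u' v' j) v" using eq by simp
    then show ?thesis using 1 assms by (auto simp: count_path_point)
  next
    case 2
    have "count (path_point k u v i) u = count (path_point k u' v' j) u" using eq by simp
    then show ?thesis using 2 assms by (auto simp: count_path_point)
  qed
next
  assume "(u' = u \<and> v' = v \<and> j = i) \<or> (u' = v \<and> v' = u \<and> j = k - i)"
  then show "path_point k u v i = path_point k u' v' j"
    using assms by (auto simp: path_point_rev)
qed

lemma pair_graph_k_subdivision: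
  assumes "pair_graph G"
  shows "pair_graph (k_subdivision k G)"
proof -
  interpret pair_graph G by fact
  let ?V = "pverts (k_subdivision k G)" and ?E = "parcs (k_subdivision k G)"
  have irr: "u \<noteq> v" if "(u, v) \<in> parcs G" for u v
    using pair_no_loops[OF that] by simp
  have rev: "(v, u) \<in> parcs G" if "(u, v) \<in> parcs G" for u v
    using pair_sym_arcs that by (auto simp: symmetric_def sym_def)
  have pt: "path_point k u v i \<in> ?V" if uv: "(u, v) \<in> parcs G" and i: "i \<le> k" for u v i
  proof -
    consider "i = 0" | "i = k" | "0 < i" "i < k" using i by linarith
    then show ?thesis
      using uv in_arcsD1[OF uv] in_arcsD2[OF uv]
      by cases (auto simp: k_subdivision_def)
  qed
  have E_V: "x \<in> ?V \<and> y \<in> ?V" if "(x, y) \<in> ?E" for x y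
  proof -
    from that obtain u v i where "(u, v) \<in> parcs G" "i < k"
      "x = path_point k u v i" "y = path_point k u v (Suc i)"
      by (auto simp: k_subdivision_def)
    then show ?thesis using pt[of u v i] pt[of u v "Suc i"] by simp
  qed
  have fin: "finite ?V"
  proof -
    have "?V \<subseteq> replicate_mset k ` pverts G
        \<union> (\<lambda>((u, v), i). path_point k u v i) ` (parcs G \<times> {..<k})"
    proof
      fix x assume "x \<in> ?V"
      then consider "x \<in> replicate_mset k ` pverts G"
        | u v i where "x = path_point k u v i" "(u, v) \<in> parcs G" "i < k"
        by (auto simp: k_subdivision_def)
      then show "x \<in> replicate_mset k ` pverts G
          \<union> (\<lambda>((u, v), i). path_point k u v i) ` (parcs G \<times> {..<k})"
        by cases force+
    qed
    then show ?thesis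
      using pair_finite_verts pair_finite_arcs by (meson finite_SigmaI finite_Un finite_imageI
          finite_lessThan finite_subset)
  qed
  have finE: "finite ?E"
    by (rule finite_subset[OF _ finite_cartesian_product[OF fin fin]]) (use E_V in auto)
  have sym: "sym ?E"
  proof (rule symI)
    fix x y assume "(x, y) \<in> ?E"
    then obtain u v i where e: "(u, v) \<in> parcs G" "i < k"
      "x = path_point k u v i" "y = path_point k u v (Suc i)"
      by (auto simp: k_subdivision_def)
    have "y = path_point k v u (k - Suc i)" "x = path_point k v u (Suc (k - Suc i))"
      using e path_point_rev[of "Suc i" k v u] path_point_rev[of i k v u]
      by (auto simp: Suc_diff_Suc)
    moreover have "k - Suc i < k" using e(2) by simp
    ultimately show "(y, x) \<in> ?E"
      using rev[OF e(1)] unfolding k_subdivision_def by simp blast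
  qed
  have loop: "x \<noteq> y" if "(x, y) \<in> ?E" for x y
  proof
    assume "x = y"
    from that obtain u v i where e: "(u, v) \<in> parcs G" "i < k"
      "x = path_point k u v i" "y = path_point k u v (Suc i)"
      by (auto simp: k_subdivision_def)
    have "count x v = count y v" using \<open>x = y\<close> by simp
    then show False using e irr[OF e(1)] by (auto simp: count_path_point)
  qed
  show ?thesis
    by unfold_locales (use E_V fin finE sym loop in \<open>auto simp: symmetric_def\<close>)
qed

text \<open>Agreement with the library's isomorphisms, which carry a separate arc map.\<close>

lemma automorphism_iff_digraph_isomorphism:
  assumes "pair_graph G"
  shows "automorphism G f \<longleftrightarrow>
    (\<exists>h. pre_digraph.digraph_isomorphism (with_proj G) h \<and>
         app_iso h (with_proj G) = with_proj G \<and> iso_verts h = f)"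
proof
  interpret pair_graph G by fact
  have wf: "wf_digraph (with_proj G)" by unfold_locales
  {
    assume "automorphism G f"
    then have bij: "bij_betw f (pverts G) (pverts G)"
      and adj: "\<And>u v. u \<in> pverts G \<Longrightarrow> v \<in> pverts G \<Longrightarrow>
        (u, v) \<in> parcs G \<longleftrightarrow> (f u, f v) \<in> parcs G"
      by (auto simp: automorphism_def)
    let ?h = "\<lparr>iso_verts = f, iso_arcs = map_prod f f, iso_head = snd, iso_tail = fst\<rparr>"
    have inj: "inj_on (map_prod f f) (parcs G)"
      using bij in_arcsD1 in_arcsD2 unfolding bij_betw_def inj_on_def by (auto; blast)
    have img: "map_prod f f ` parcs G = parcs G"
    proof
      show "map_prod f f ` parcs G \<subseteq> parcs G"
        using adj by (auto dest: in_arcsD1 in_arcsD2)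
      show "parcs G \<subseteq> map_prod f f ` parcs G"
      proof (rule subrelI)
        fix x y assume xy: "(x, y) \<in> parcs G"
        then obtain u v where "u \<in> pverts G" "v \<in> pverts G" "x = f u" "y = f v"
          using bij in_arcsD1 in_arcsD2 unfolding bij_betw_def by blast
        then show "(x, y) \<in> map_prod f f ` parcs G" using xy adj by force
      qed
    qed
    have "pre_digraph.digraph_isomorphism (with_proj G) ?h"
      using wf bij inj by (simp add: pre_digraph.digraph_isomorphism_def bij_betw_def)
    moreover have "app_iso ?h (with_proj G) = with_proj G"
      using bij img by (simp add: app_iso_def with_proj_def bij_betw_def)
    ultimately show "\<exists>h. pre_digraph.digraph_isomorphism (with_proj G) h \<and>
        app_iso h (with_proj G) = with_proj G \<and> iso_verts h = f"
      by (intro exI[of _ ?h]) simp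
  }
  {
    assume "\<exists>h. pre_digraph.digraph_isomorphism (with_proj G) h \<and>
        app_iso h (with_proj G) = with_proj G \<and> iso_verts h = f"
    then obtain h where h: "pre_digraph.digraph_isomorphism (with_proj G) h"
      and app: "app_iso h (with_proj G) = with_proj G" and f: "iso_verts h = f" by blast
    from app have img: "f ` pverts G = pverts G" "iso_arcs h ` parcs G = parcs G"
      "iso_tail h = fst" "iso_head h = snd"
      using f by (simp_all add: app_iso_def with_proj_def)
    from h have inj: "inj_on f (pverts G)"
      and ends: "\<And>a. a \<in> parcs G \<Longrightarrow> iso_arcs h a = (f (fst a), f (snd a))"
      using f img by (auto simp: pre_digraph.digraph_isomorphism_def prod_eq_iff)
    have "(u, v) \<in> parcs G \<longleftrightarrow> (f u, f v) \<in> parcs G"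
      if uv: "u \<in> pverts G" "v \<in> pverts G" for u v
    proof
      assume "(u, v) \<in> parcs G"
      then show "(f u, f v) \<in> parcs G" using ends img(2) by force
    next
      assume "(f u, f v) \<in> parcs G"
      then obtain a where a: "a \<in> parcs G" "iso_arcs h a = (f u, f v)" using img(2) by (metis imageE)
      then have "f (fst a) = f u" "f (snd a) = f v" using ends by auto
      then have "fst a = u" "snd a = v"
        using inj uv a(1) arc_fst_in_verts arc_snd_in_verts by (auto dest: inj_onD)
      then show "(u, v) \<in> parcs G" using a(1) by auto
    qed
    then show "automorphism G f" using inj img(1) by (auto simp: automorphism_def bij_betw_def)
  }
qed

end

theory Submission
  imports Defs "HOL-Library.FuncSet"
begin

text \<open>
  Since \<open>2 ^ k + (\<Sum>j=3..s. j ^ (k - 1)) \<le> s ^ k\<close>, it suffices to find a distinguishing labeling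
  with \<open>s\<close> labels whenever the maximum degree is at most \<open>s ^ k\<close>. Search \<open>G\<close> from a root \<open>r\<close> and
  call \<open>v\<close> a child of its earliest neighbour \<open>p\<close>. The labels on the path from \<open>p\<close> to \<open>v\<close>, without
  \<open>p\<close> but with \<open>v\<close>, form a word in \<open>{1..s} ^ k\<close>. If siblings get different words, then an
  automorphism that preserves the labels and fixes \<open>r\<close> fixes everything, along the search order.

  To fix \<open>r\<close>, choose it of degree at least 3, so that automorphisms send it to a vertex of \<open>G\<close>.
  Label \<open>r\<close> by 2 and give one of its children the word \<open>1\<dots>1\<close>. A vertex \<open>p \<noteq> r\<close> has fewer children
  than neighbours, so one word may be forbidden for them: \<open>1\<dots>12\<close> if \<open>p\<close> has label 1 and \<open>1\<dots>1\<close>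
  otherwise. With label 2 inside the paths of all remaining edges, a path reading \<open>2 1\<dots>1\<close>
  starts at \<open>r\<close> only. If all degrees are at most 2, labels on three vertices suffice.
\<close>

section \<open>Arithmetic of the bound\<close>

text \<open>The sides agree for \<open>s = 2\<close>. Passing from \<open>m\<close> to
  \<open>Suc m\<close> adds \<open>Suc m ^ (k - 1)\<close> on the left and at least as much on the
  right.\<close>

lemma two_power_plus_sum_le_power:
  fixes s k :: nat
  assumes "2 \<le> s" "1 \<le> k"
  shows "2 ^ k + (\<Sum>j=3..s. j ^ (k - 1)) \<le> s ^ k"
  using assms(1)
proof (induction s rule: dec_induct)
  case base
  then show ?case by simp
next
  case (step m)
  have "m ^ k + Suc m ^ (k - 1) \<le> m * Suc m ^ (k - 1) + Suc m ^ (k - 1)"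
    using assms(2) by (cases k) (auto intro!: mult_le_mono power_mono)
  also have "\<dots> = Suc m ^ k" using assms(2) by (cases k) auto
  finally show ?case using step by simp
qed

text \<open>The sum up to \<open>n + 2\<close> has \<open>n\<close> terms, each at least 1. This
  makes the minimum in the bound exist.\<close>

lemma ex_two_power_plus_sum_ge:
  fixes k n :: nat
  shows "\<exists>s\<ge>2. n \<le> 2 ^ k + (\<Sum>j=3..s. j ^ (k - 1))"
proof (intro exI[of _ "n + 2"] conjI)
  have "n = (\<Sum>j=3..n + 2. 1)" by simp
  also have "\<dots> \<le> (\<Sum>j=3..n + 2. j ^ (k - 1))" by (rule sum_mono) simp
  finally show "n \<le> 2 ^ k + (\<Sum>j=3..n + 2. j ^ (k - 1))" by simp
qed simp

section \<open>Vertices and arcs of the subdivision\<close>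

locale subdivided_graph = pair_graph G for G :: "'a pair_pre_digraph" +
  fixes k :: nat
  assumes k_ge_2: "2 \<le> k"
begin

abbreviation "H \<equiv> k_subdivision k G"
abbreviation "pt \<equiv> path_point k"
abbreviation "branch \<equiv> replicate_mset k"
abbreviation nbrs :: "'a \<Rightarrow> 'a set" where "nbrs v \<equiv> {u. (v, u) \<in> parcs G}"

lemma arc_irrefl: "(u, v) \<in> parcs G \<Longrightarrow> u \<noteq> v"
  using pair_no_loops by fastforce

lemma arc_rev: "(u, v) \<in> parcs G \<Longrightarrow> (v, u) \<in> parcs G"
  using pair_sym_arcs by (auto simp: symmetric_def sym_def)

lemma finite_nbrs: "finite (nbrs v)"
  by (rule finite_subset[OF _ pair_finite_verts]) (auto dest: in_arcsD2)

lemma out_degree_eq: "out_degree (with_proj G) v = card (nbrs v)"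
proof -
  have "out_arcs (with_proj G) v = Pair v ` nbrs v" by (auto simp: out_arcs_def)
  then show ?thesis by (simp add: out_degree_def card_image inj_on_def)
qed

lemma card_nbrs_le: "v \<in> pverts G \<Longrightarrow> card (nbrs v) \<le> max_degree G"
  unfolding max_degree_def using pair_finite_verts by (auto simp: out_degree_eq intro!: Max_ge)

lemma branch_eq_iff: "branch u = branch v \<longleftrightarrow> u = v"
  using k_ge_2 by (auto simp: multiset_eq_iff split: if_splits)

lemma branch_neq_pt:
  assumes "(u, v) \<in> parcs G" "0 < i" "i < k"
  shows "branch x \<noteq> pt u v i"
proof
  assume "branch x = pt u v i"
  then have "set_mset (branch x) = set_mset (pt u v i)" by simp
  then show False using assms arc_irrefl[OF assms(1)] k_ge_2 by (auto simp: path_point_def)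
qed

lemma pt_1_eq_iff:
  assumes "(v, u) \<in> parcs G" "(v, u') \<in> parcs G"
  shows "pt v u 1 = pt v u' 1 \<longleftrightarrow> u = u'"
  using path_point_eq_iff[OF arc_irrefl[OF assms(1)] arc_irrefl[OF assms(2)], of 1 k 1]
    arc_irrefl[OF assms(1)] k_ge_2 by auto

lemma branch_in_H: "v \<in> pverts G \<Longrightarrow> branch v \<in> pverts H"
  by (simp add: k_subdivision_def)

lemma pt_in_H:
  assumes "(u, v) \<in> parcs G" "i \<le> k"
  shows "pt u v i \<in> pverts H"
proof -
  consider "i = 0" | "i = k" | "0 < i" "i < k" using assms by linarith
  then show ?thesis
    using assms(1) in_arcsD1[OF assms(1)] in_arcsD2[OF assms(1)]
    by cases (auto simp: k_subdivision_def)
qed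

lemma H_vert_cases:
  assumes "x \<in> pverts H"
  obtains (branch) v where "v \<in> pverts G" "x = branch v"
    | (inner) u v i where "(u, v) \<in> parcs G" "0 < i" "i < k" "x = pt u v i"
  using assms by (auto simp: k_subdivision_def)

lemma H_arcI: "(u, v) \<in> parcs G \<Longrightarrow> i < k \<Longrightarrow> (pt u v i, pt u v (Suc i)) \<in> parcs H"
  by (auto simp: k_subdivision_def)

lemma H_arcE:
  assumes "(x, y) \<in> parcs H"
  obtains u v i where "(u, v) \<in> parcs G" "i < k" "x = pt u v i" "y = pt u v (Suc i)"
  using assms by (auto simp: k_subdivision_def)

lemma H_arc_rev:
  assumes "(x, y) \<in> parcs H"
  shows "(y, x) \<in> parcs H"
proof -
  interpret H: pair_graph H by (rule pair_graph_k_subdivision) unfold_locales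
  show ?thesis using assms H.pair_sym_arcs by (auto simp: symmetric_def sym_def)
qed

lemma H_nbr_branch:
  assumes "(branch v, y) \<in> parcs H"
  obtains u where "(v, u) \<in> parcs G" "y = pt v u 1"
proof -
  from assms obtain a b j where ab: "(a, b) \<in> parcs G" "j < k"
    "branch v = pt a b j" "y = pt a b (Suc j)" by (rule H_arcE)
  from ab have "j = 0" using branch_neq_pt[of a b j v] by auto
  with ab show thesis by (intro that[of b]) (auto simp: branch_eq_iff)
qed

text \<open>An inner point is described once from \<open>v\<close> and once from \<open>u\<close>; a
  forward step in the second description is a backward step in the first.\<close>

lemma H_nbr_inner:
  assumes vu: "(v, u) \<in> parcs G" and i: "0 < i" "i < k" and arc: "(pt v u i, y) \<in> parcs H"
  shows "y = pt v u (i - 1) \<or> y = pt v u (Suc i)"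
proof -
  from arc obtain a b j where ab: "(a, b) \<in> parcs G" "j < k"
    "pt v u i = pt a b j" "y = pt a b (Suc j)" by (rule H_arcE)
  have "j \<noteq> 0" using ab branch_neq_pt[OF vu i, of a] by (metis path_point_0)
  then consider "a = v" "b = u" "j = i" | "a = u" "b = v" "j = k - i"
    using path_point_eq_iff[OF arc_irrefl[OF vu] arc_irrefl[OF ab(1)] i, of j] ab by auto
  then show ?thesis
  proof cases
    case 2
    then have "y = pt u v (k - (i - 1))" using ab i by (simp add: Suc_diff_le)
    also have "\<dots> = pt v u (i - 1)" using i by (intro path_point_rev) simp
    finally show ?thesis by simp
  qed (use ab in simp)
qed

section \<open>Automorphisms along subdivided edges\<close>

lemma automorphismD:
  assumes "automorphism H f"
  shows "x \<in> pverts H \<Longrightarrow> f x \<in> pverts H"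
    and "x \<in> pverts H \<Longrightarrow> y \<in> pverts H \<Longrightarrow> f x = f y \<Longrightarrow> x = y"
    and "x \<in> pverts H \<Longrightarrow> y \<in> pverts H \<Longrightarrow> (f x, f y) \<in> parcs H \<longleftrightarrow> (x, y) \<in> parcs H"
  using assms unfolding automorphism_def by (auto simp: bij_betw_def inj_on_def)

text \<open>Inner points have only two neighbours, so by injectivity the image of a path cannot turn
  back before it reaches the next branch vertex.\<close>

lemma automorphism_path:
  assumes f: "automorphism H f" and vu: "(v, u) \<in> parcs G" and fv: "f (branch v) = branch v'"
  obtains u' where "(v', u') \<in> parcs G" "\<And>i. i \<le> k \<Longrightarrow> f (pt v u i) = pt v' u' i"
proof -
  note D = automorphismD[OF f]
  have step: "(f (pt v u i), f (pt v u (Suc i))) \<in> parcs H" if "i < k" for i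
    using D(3) pt_in_H[OF vu] H_arcI[OF vu that] that by simp
  have "(branch v', f (pt v u 1)) \<in> parcs H" using step[of 0] k_ge_2 fv by simp
  then obtain u' where u': "(v', u') \<in> parcs G" "f (pt v u 1) = pt v' u' 1"
    by (rule H_nbr_branch)
  \<comment> \<open>The induction carries two consecutive points, as the earlier one is what
    excludes turning back.\<close>
  have "Suc i \<le> k \<longrightarrow> f (pt v u i) = pt v' u' i \<and> f (pt v u (Suc i)) = pt v' u' (Suc i)" for i
  proof (induction i)
    case 0
    then show ?case using u' fv by simp
  next
    case (Suc i)
    show ?case
    proof
      assume le: "Suc (Suc i) \<le> k"
      with Suc have IH: "f (pt v u i) = pt v' u' i" "f (pt v u (Suc i)) = pt v' u' (Suc i)"
        by auto
      have "(pt v' u' (Suc i), f (pt v u (Suc (Suc i)))) \<in> parcs H"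
        using step[of "Suc i"] le IH by simp
      then consider "f (pt v u (Suc (Suc i))) = pt v' u' i"
        | "f (pt v u (Suc (Suc i))) = pt v' u' (Suc (Suc i))"
        using H_nbr_inner[OF u'(1), of "Suc i"] le by auto
      then show "f (pt v u (Suc i)) = pt v' u' (Suc i)
          \<and> f (pt v u (Suc (Suc i))) = pt v' u' (Suc (Suc i))"
      proof cases
        case 1
        then have "pt v u (Suc (Suc i)) = pt v u i"
          using IH D(2) pt_in_H[OF vu] le by simp
        then have "count (pt v u (Suc (Suc i))) u = count (pt v u i) u" by simp
        then show ?thesis using arc_irrefl[OF vu] by (simp add: count_path_point)
      qed (use IH in simp)
    qed
  qed
  then have "f (pt v u i) = pt v' u' i" if "i \<le> k" for i
    using that fv by (cases i) auto
  with u'(1) show thesis by (rule that)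
qed

section \<open>Search orders, parents and rigidity\<close>

definition search_order :: "'a \<Rightarrow> ('a \<Rightarrow> nat) \<Rightarrow> bool" where
  "search_order r ord \<longleftrightarrow> r \<in> pverts G \<and> inj_on ord (pverts G) \<and>
     (\<forall>v\<in>pverts G. v \<noteq> r \<longrightarrow> (\<exists>u. (v, u) \<in> parcs G \<and> ord u < ord v))"

text \<open>
  The earliest neighbour, rather than any neighbour one level up, is needed for rigidity: a
  neighbour of \<open>p\<close> that is not a child of \<open>p\<close> is then adjacent to a vertex earlier than \<open>p\<close>, hence
  already fixed, and cannot be confused with a child of \<open>p\<close>.
\<close>

definition children :: "'a \<Rightarrow> ('a \<Rightarrow> nat) \<Rightarrow> 'a \<Rightarrow> 'a set" where
  "children r ord p = {v \<in> nbrs p. v \<noteq> r \<and> (\<forall>u. (v, u) \<in> parcs G \<longrightarrow> ord p \<le> ord u)}"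

text \<open>Breadth-first search, with ties broken by an arbitrary enumeration.\<close>

lemma ex_search_order:
  assumes con: "connected (with_proj G)" and r: "r \<in> pverts G"
  shows "\<exists>ord. search_order r ord"
proof -
  define d where "d v = (LEAST n. (v, r) \<in> parcs G ^^ n)" for v
  obtain e :: "'a \<Rightarrow> nat" and N where e: "inj_on e (pverts G)" "e ` pverts G = {..<N}"
    using finite_imp_inj_to_nat_seg[OF pair_finite_verts] by (metis lessThan_def)
  have eN: "e v < N" if "v \<in> pverts G" for v using e(2) that by auto
  \<comment> \<open>Distance to \<open>r\<close> decides first and \<open>e < N\<close> breaks ties;
    \<open>e\<close> is recovered modulo \<open>N\<close>, which gives injectivity.\<close>
  define ord where "ord v = d v * N + e v" for v
  have inj: "inj_on ord (pverts G)"
  proof (rule inj_onI)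
    fix x y assume xy: "x \<in> pverts G" "y \<in> pverts G" "ord x = ord y"
    have "ord v mod N = e v" if "v \<in> pverts G" for v
      unfolding ord_def using eN[OF that] by simp
    then have "e x = e y" using xy by metis
    then show "x = y" using xy e(1) by (simp add: inj_on_def)
  qed
  have "\<exists>u. (v, u) \<in> parcs G \<and> ord u < ord v" if v: "v \<in> pverts G" "v \<noteq> r" for v
  proof -
    have "strongly_connected (with_proj G)"
      using con symmetric_connected_imp_strongly_connected pair_sym_arcs by blast
    then have "v \<rightarrow>\<^sup>*\<^bsub>with_proj G\<^esub> r"
      using v r by (auto simp: strongly_connected_def)
    then have "(v, r) \<in> (arcs_ends (with_proj G))\<^sup>*"
      unfolding reachable_def by (rule rtrancl_on_rtranclI)
    then have "(v, r) \<in> (parcs G)\<^sup>*" by (simp add: arcs_ends_def arc_to_ends_def)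
    then have dv: "(v, r) \<in> parcs G ^^ d v"
      unfolding d_def by (metis LeastI rtrancl_power)
    then obtain m where m: "d v = Suc m" using v(2) by (cases "d v") auto
    with dv obtain u where u: "(v, u) \<in> parcs G" "(u, r) \<in> parcs G ^^ m"
      by (metis relpow_Suc_E2)
    have "d u \<le> m" unfolding d_def using u(2) by (rule Least_le)
    then have "d u * N \<le> m * N" by simp
    moreover have "e u < N" using eN u(1) in_arcsD2 by blast
    ultimately have "ord u < ord v" unfolding ord_def m mult_Suc by linarith
    with u(1) show ?thesis by blast
  qed
  with inj r show ?thesis unfolding search_order_def by blast
qed

context
  fixes r :: 'a and ord :: "'a \<Rightarrow> nat"
  assumes so: "search_order r ord"
begin

lemma ord_eq: "u \<in> pverts G \<Longrightarrow> v \<in> pverts G \<Longrightarrow> ord u = ord v \<Longrightarrow> u = v"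
  using so by (auto simp: search_order_def inj_on_def)

lemma earlier_nbr:
  assumes "v \<in> pverts G" "v \<noteq> r"
  obtains u where "(v, u) \<in> parcs G" "ord u < ord v"
  using assms so by (auto simp: search_order_def)

text \<open>Descending through earlier neighbours can only stop at \<open>r\<close>.\<close>

lemma root_least: "v \<in> pverts G \<Longrightarrow> ord r \<le> ord v"
proof (induction "ord v" arbitrary: v rule: less_induct)
  case less
  show ?case
  proof (cases "v = r")
    case False
    then obtain u where "(v, u) \<in> parcs G" "ord u < ord v"
      using earlier_nbr less by blast
    then show ?thesis using less.hyps[of u] in_arcsD2[of v u] by simp
  qed simp
qed

lemma ex_parent:
  assumes v: "v \<in> pverts G" "v \<noteq> r"
  shows "\<exists>p. v \<in> children r ord p"
proof -
  define p where "p = (ARG_MIN ord u. (v, u) \<in> parcs G)"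
  obtain u where "(v, u) \<in> parcs G" using earlier_nbr[OF v] by blast
  then have "(v, p) \<in> parcs G" "\<forall>u. (v, u) \<in> parcs G \<longrightarrow> ord p \<le> ord u"
    unfolding p_def using arg_min_nat_lemma[of "\<lambda>u. (v, u) \<in> parcs G"] by blast+
  then show ?thesis using v(2) arc_rev by (auto simp: children_def)
qed

lemma children_root: "children r ord r = nbrs r"
  using root_least arc_irrefl in_arcsD2 by (auto simp: children_def)

lemma children_nbrs: "children r ord p \<subseteq> nbrs p"
  by (auto simp: children_def)

text \<open>An earlier neighbour of \<open>p\<close> is the root or has a neighbour earlier still,
  so \<open>p\<close> is not its parent.\<close>

lemma earlier_nbr_not_child:
  assumes p: "p \<in> pverts G" "p \<noteq> r"
  obtains q where "q \<in> nbrs p" "q \<notin> children r ord p"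
proof -
  obtain q where q: "(p, q) \<in> parcs G" "ord q < ord p" using earlier_nbr[OF p] .
  have "q \<notin> children r ord p"
  proof
    assume "q \<in> children r ord p"
    then have c: "q \<noteq> r" "\<And>u. (q, u) \<in> parcs G \<Longrightarrow> ord p \<le> ord u" by (auto simp: children_def)
    obtain u where "(q, u) \<in> parcs G" "ord u < ord q"
      using earlier_nbr[of q] c(1) in_arcsD2[OF q(1)] by blast
    then show False using c(2)[of u] q(2) by simp
  qed
  then show thesis using q(1) by (intro that[of q]) auto
qed

text \<open>The gap leaves room for one forbidden word.\<close>

lemma card_children_less:
  assumes "p \<in> pverts G" "p \<noteq> r"
  shows "card (children r ord p) < card (nbrs p)"
  using earlier_nbr_not_child[OF assms] children_nbrs[of p] finite_nbrs
  by (metis psubsetI psubset_card_mono)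

lemma children_disjoint:
  assumes "v \<in> children r ord p" "v \<in> children r ord q"
  shows "p = q"
proof -
  from assms have a: "(p, v) \<in> parcs G" "(q, v) \<in> parcs G"
    "\<And>u. (v, u) \<in> parcs G \<Longrightarrow> ord p \<le> ord u \<and> ord q \<le> ord u"
    by (auto simp: children_def)
  have "ord p = ord q" using a(3)[OF arc_rev[OF a(1)]] a(3)[OF arc_rev[OF a(2)]] by simp
  then show ?thesis using ord_eq in_arcsD1 a by blast
qed

text \<open>Some neighbour of \<open>v\<close> is earlier than \<open>v\<close>, and the parent is
  the earliest one. This makes recursion from parents to children well-founded.\<close>

lemma child_later:
  assumes "v \<in> children r ord p"
  shows "ord p < ord v"
proof -
  have pv: "(p, v) \<in> parcs G" and "v \<noteq> r" using assms by (auto simp: children_def)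
  then obtain u where "(v, u) \<in> parcs G" "ord u < ord v"
    using earlier_nbr[of v] in_arcsD2 by blast
  then show ?thesis using assms by (force simp: children_def)
qed

lemma non_child_cases:
  assumes pv: "(p, v) \<in> parcs G" and "v \<notin> children r ord p"
  obtains "v = r" | q where "q \<in> pverts G" "ord q < ord p" "(q, v) \<in> parcs G"
proof (cases "v = r")
  case False
  then obtain q where "(v, q) \<in> parcs G" "ord q < ord p"
    using assms by (fastforce simp: children_def)
  then show thesis using that(2)[of q] arc_rev in_arcsD2 by blast
qed

text \<open>Induction on \<open>ord p\<close> shows that all neighbours of \<open>p\<close> are
  fixed. The vertex \<open>p\<close> is fixed as a neighbour of an earlier vertex, or as the root;
  its children are then kept apart by \<open>sep\<close>. Inner points follow from the ends of their
  paths.\<close>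

lemma rigid:
  assumes f: "automorphism H f" and L: "\<And>x. x \<in> pverts H \<Longrightarrow> L (f x) = L x"
    and fr: "f (branch r) = branch r"
    and sep: "\<And>p v v'. p \<in> pverts G \<Longrightarrow> v \<in> children r ord p \<Longrightarrow> v' \<in> children r ord p \<Longrightarrow>
      (\<And>i. 0 < i \<Longrightarrow> i \<le> k \<Longrightarrow> L (pt p v i) = L (pt p v' i)) \<Longrightarrow> v = v'"
    and x: "x \<in> pverts H"
  shows "f x = x"
proof -
  note D = automorphismD[OF f]
  have fix_nbr: "f (branch v) = branch v"
    if p: "p \<in> pverts G" and pv: "(p, v) \<in> parcs G" for p v
    using that
  proof (induction "ord p" arbitrary: p v rule: less_induct)
    case less
    have fp: "f (branch p) = branch p"
    proof (cases "p = r")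
      case False
      then obtain u where u: "(p, u) \<in> parcs G" "ord u < ord p"
        using earlier_nbr less.prems(1) by blast
      show ?thesis using less.hyps[of u p] u arc_rev in_arcsD2 by blast
    qed (simp add: fr)
    have old: "f (branch w) = branch w" if "(p, w) \<in> parcs G" "w \<notin> children r ord p" for w
      using that
    proof (cases rule: non_child_cases)
      case (2 q)
      then show ?thesis using less.hyps by blast
    qed (simp add: fr)
    show ?case
    proof (cases "v \<in> children r ord p")
      case True
      obtain v' where v': "(p, v') \<in> parcs G" "\<And>i. i \<le> k \<Longrightarrow> f (pt p v i) = pt p v' i"
        using automorphism_path[OF f less.prems(2) fp] by blast
      have fv: "f (branch v) = branch v'" using v'(2)[of k] by simp
      have "v = v'"
      proof (cases "v' \<in> children r ord p")
        case c: True
        show ?thesis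
        proof (rule sep[OF less.prems(1) True c])
          fix i assume "0 < i" "i \<le> k"
          then show "L (pt p v i) = L (pt p v' i)"
            using L[OF pt_in_H[OF less.prems(2), of i]] v'(2)[of i] by simp
        qed
      next
        \<comment> \<open>Here \<open>v'\<close> is already fixed, so \<open>v\<close> and
          \<open>v'\<close> have the same image.\<close>
        case False
        then have "f (branch v') = f (branch v)" using old v'(1) fv by simp
        then show ?thesis
          using D(2) branch_in_H in_arcsD2[OF v'(1)] in_arcsD2[OF less.prems(2)] branch_eq_iff
          by metis
      qed
      then show ?thesis using fv by simp
    qed (use old less.prems in blast)
  qed
  have fix_branch: "f (branch v) = branch v" if v: "v \<in> pverts G" for v
  proof (cases "v = r")
    case False
    then obtain u where "(v, u) \<in> parcs G" using earlier_nbr v by blast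
    then show ?thesis using fix_nbr arc_rev in_arcsD2 by blast
  qed (simp add: fr)
  show ?thesis using x
  proof (cases rule: H_vert_cases)
    case (inner u v i)
    obtain v' where v': "(u, v') \<in> parcs G" "\<And>i. i \<le> k \<Longrightarrow> f (pt u v i) = pt u v' i"
      using automorphism_path[OF f inner(1) fix_branch] in_arcsD1[OF inner(1)] by blast
    have "branch v' = branch v"
      using v'(2)[of k] fix_branch[OF in_arcsD2[OF inner(1)]] by simp
    then have "v' = v" by (simp add: branch_eq_iff)
    then show ?thesis using v'(2)[of i] inner by simp
  qed (use fix_branch in simp)
qed

end

section \<open>Labelings from edge data, and images of branch vertices\<close>

text \<open>An inner point has exactly the two names \<open>(u, v, i)\<close> and
  \<open>(v, u, k - i)\<close>; by \<open>sym\<close> its label does not depend on the one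
  chosen.\<close>

lemma ex_labeling:
  assumes sym: "\<And>u v i. (u, v) \<in> parcs G \<Longrightarrow> 0 < i \<Longrightarrow> i < k \<Longrightarrow> w v u (k - i) = w u v i"
  shows "\<exists>L. (\<forall>v. L (branch v) = c v) \<and>
    (\<forall>u v i. (u, v) \<in> parcs G \<longrightarrow> 0 < i \<longrightarrow> i < k \<longrightarrow> L (pt u v i) = w u v i)"
proof -
  define Q where "Q x t \<longleftrightarrow> (\<exists>u v i. t = (u, v, i) \<and> (u, v) \<in> parcs G \<and> 0 < i \<and> i < k \<and>
    x = pt u v i)" for x :: "'a multiset" and t :: "'a \<times> 'a \<times> nat"
  define L where "L x = (if \<exists>v. x = branch v then c (THE v. x = branch v)
    else case (SOME t. Q x t) of (u, v, i) \<Rightarrow> w u v i)" for x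
  have "L (branch v) = c v" for v by (auto simp: L_def branch_eq_iff)
  moreover have "L (pt u v i) = w u v i" if uv: "(u, v) \<in> parcs G" and i: "0 < i" "i < k" for u v i
  proof -
    have "Q (pt u v i) (u, v, i)" using that by (auto simp: Q_def)
    then have "Q (pt u v i) (SOME t. Q (pt u v i) t)" by (rule someI)
    then obtain a b j where t: "(SOME t. Q (pt u v i) t) = (a, b, j)" "(a, b) \<in> parcs G"
      "0 < j" "j < k" "pt u v i = pt a b j" by (auto simp: Q_def)
    have "L (pt u v i) = w a b j"
      unfolding L_def t(1) using branch_neq_pt[OF uv i] by (metis (no_types) case_prod_conv)
    also have "\<dots> = w u v i"
      using t path_point_eq_iff[OF arc_irrefl[OF uv] arc_irrefl[OF t(2)] i t(3,4)] sym[OF uv i]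
      by auto
    finally show ?thesis .
  qed
  ultimately show ?thesis by blast
qed

text \<open>An inner point has at most two neighbours, too few to receive those of
  \<open>branch r\<close>.\<close>

lemma automorphism_branch:
  assumes f: "automorphism H f" and r: "r \<in> pverts G" and deg: "3 \<le> card (nbrs r)"
  obtains r' where "r' \<in> pverts G" "f (branch r) = branch r'"
proof -
  note D = automorphismD[OF f]
  from D(1)[OF branch_in_H[OF r]] show thesis
  proof (cases rule: H_vert_cases)
    case (inner u v i)
    define g where "g x = f (pt r x 1)" for x
    have "g ` nbrs r \<subseteq> {pt u v (i - 1), pt u v (Suc i)}"
    proof (rule image_subsetI)
      fix x assume "x \<in> nbrs r"
      then have x: "(r, x) \<in> parcs G" by simp
      have "(f (branch r), g x) \<in> parcs H"
        unfolding g_def using D(3) H_arcI[OF x, of 0] branch_in_H[OF r] pt_in_H[OF x] k_ge_2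
        by simp
      then show "g x \<in> {pt u v (i - 1), pt u v (Suc i)}"
        using H_nbr_inner[OF inner(1-3)] inner(4) by auto
    qed
    moreover have "inj_on g (nbrs r)"
    proof (rule inj_onI, clarify)
      fix x y assume "(r, x) \<in> parcs G" "(r, y) \<in> parcs G" "g x = g y"
      then show "x = y" using D(2) pt_in_H k_ge_2 pt_1_eq_iff unfolding g_def
        by (metis one_le_numeral order_trans)
    qed
    ultimately have "card (nbrs r) \<le> card {pt u v (i - 1), pt u v (Suc i)}"
      by (metis card_inj_on_le finite.emptyI finite_insert)
    also have "\<dots> \<le> 2" by (simp add: card_insert_if)
    finally show ?thesis using deg by simp
  qed (use that in blast)
qed

section \<open>Paths and cycles\<close>

text \<open>
  Here automorphisms may move vertices of \<open>G\<close> to subdivision points. Label 1 goes to \<open>r\<close>, to the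
  next point \<open>x\<close> on one side and to the second point \<open>y\<close> on the other side: \<open>y\<close> is the
  isolated one of the three, and of the other two only \<open>r\<close> has a common neighbour with \<open>y\<close>.
\<close>

lemma ex_labeling_max_degree_2:
  assumes con: "connected (with_proj G)" and deg: "\<And>v. v \<in> pverts G \<Longrightarrow> card (nbrs v) \<le> 2"
    and r: "(r, a) \<in> parcs G" "(r, b) \<in> parcs G" "a \<noteq> b" and s: "2 \<le> s"
  shows "\<exists>L. distinguishing_labeling H s L"
proof -
  have rV: "r \<in> pverts G" using r in_arcsD1 by blast
  obtain ord where so: "search_order r ord" using ex_search_order[OF con rV] by blast
  have [simp]: "r \<noteq> a" "r \<noteq> b" "a \<noteq> r" "b \<noteq> r" "b \<noteq> a" using r arc_irrefl by auto
  \<comment> \<open>For \<open>k = 2\<close> the point \<open>y\<close> is \<open>branch b\<close>.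
    Multiplicities of \<open>a\<close> and \<open>b\<close> tell the points apart below.\<close>
  define x y where "x = pt r a 1" and "y = pt r b 2"
  define S where "S = {branch r, x, y}"
  define L where "L z = (if z \<in> S then 1 else 2 :: nat)" for z
  have in_H: "branch r \<in> pverts H" "x \<in> pverts H" "y \<in> pverts H"
    using branch_in_H[OF rV] pt_in_H[OF r(1)] pt_in_H[OF r(2)] k_ge_2 by (auto simp: x_def y_def)
  have counts: "count (branch r) a = 0" "count (branch r) b = 0" "count x a = 1" "count x b = 0"
    "count y a = 0" "count y b = 2"
    using r by (auto simp: x_def y_def count_path_point)
  have distinct: "branch r \<noteq> x" "branch r \<noteq> y" "x \<noteq> y" using counts by auto
  have nbr_r: "z \<in> {pt r a 1, pt r b 1}" if "(branch r, z) \<in> parcs H" for z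
  proof -
    have "card {a, b} = 2" using r by simp
    then have "nbrs r = {a, b}"
      using r deg[OF rV] card_seteq[OF finite_nbrs, of "{a, b}" r] by auto
    then show ?thesis using that by (auto elim!: H_nbr_branch)
  qed
  have nbr_x: "z \<in> {branch r, pt r a 2}" if "(x, z) \<in> parcs H" for z
    using H_nbr_inner[OF r(1), of 1 z] that k_ge_2 by (auto simp: x_def numeral_2_eq_2)
  have rx: "(branch r, x) \<in> parcs H" using H_arcI[OF r(1), of 0] k_ge_2 by (simp add: x_def)
  have b1: "(branch r, pt r b 1) \<in> parcs H" "(pt r b 1, y) \<in> parcs H"
    using H_arcI[OF r(2), of 0] H_arcI[OF r(2), of 1] k_ge_2
    by (auto simp: y_def numeral_2_eq_2)
  have y_isolated: "(z, y) \<notin> parcs H" if zS: "z \<in> S" for z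
  proof
    assume zy: "(z, y) \<in> parcs H"
    have irr: "(y, y) \<notin> parcs H"
    proof -
      interpret H: pair_graph H by (rule pair_graph_k_subdivision) unfold_locales
      show ?thesis using H.pair_no_loops by fastforce
    qed
    consider "z = branch r" | "z = x" using zy zS irr unfolding S_def by blast
    then show False
    proof cases
      case 1
      then have "y \<in> {pt r a 1, pt r b 1}" using nbr_r zy by blast
      then have "count y b \<in> {count (pt r a 1) b, count (pt r b 1) b}" by auto
      then show False using counts r by (auto simp: count_path_point)
    next
      case 2
      then have "y \<in> {branch r, pt r a 2}" using nbr_x zy by blast
      then have "count y b \<in> {count (branch r) b, count (pt r a 2) b}" by auto
      then show False using counts r by (auto simp: count_path_point)
    qed
  qed
  have x_y: "False" if "(x, z) \<in> parcs H" "(z, y) \<in> parcs H" for z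
  proof -
    \<comment> \<open>The other neighbour of \<open>x\<close> is \<open>branch r\<close>, which is
      not adjacent to \<open>y\<close>.\<close>
    have z: "z = pt r a 2" using nbr_x[OF that(1)] that(2) y_isolated by (auto simp: S_def)
    show False
    proof (cases "k = 2")
      case True
      then have "(branch a, branch b) \<in> parcs H" using that(2) z by (auto simp: y_def)
      then obtain u where "(a, u) \<in> parcs G" "branch b = pt a u 1" by (rule H_nbr_branch)
      then show False using branch_neq_pt[of a u 1 b] k_ge_2 by simp
    next
      case False
      then have "y = pt r a 1 \<or> y = pt r a 3"
        using H_nbr_inner[OF r(1), of 2 y] that(2) z k_ge_2
        by (auto simp: numeral_2_eq_2 numeral_3_eq_3)
      then have "count y a = 1 \<or> count y a = 3" using r by (auto simp: count_path_point)
      then show False using counts by simp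
    qed
  qed
  have "distinguishing_labeling H s L"
    unfolding distinguishing_labeling_def
  proof (intro conjI allI impI ballI; (elim conjE)?)
    show "L ` pverts H \<subseteq> {1..s}" using s by (auto simp: L_def)
  next
    fix f v assume f: "automorphism H f" and fL: "\<forall>v\<in>pverts H. L (f v) = L v"
      and v: "v \<in> pverts H"
    note D = automorphismD[OF f]
    have S_iff: "f z \<in> S \<longleftrightarrow> z \<in> S" if "z \<in> pverts H" for z
      using fL that by (auto simp: L_def split: if_splits)
    have fS: "f (branch r) \<in> S" "f x \<in> S" "f y \<in> S"
      using S_iff in_H by (auto simp: S_def)
    have adj: "(f (branch r), f x) \<in> parcs H" using D(3) in_H rx by blast
    have "f (branch r) \<noteq> y" "f x \<noteq> y"
      using adj H_arc_rev[OF adj] y_isolated fS by auto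
    moreover have "f y \<noteq> f (branch r)" "f y \<noteq> f x" "f (branch r) \<noteq> f x"
      using D(2) in_H distinct by metis+
    ultimately consider "f (branch r) = branch r" | "f (branch r) = x" "f y = y"
      using fS by (auto simp: S_def)
    then have fr: "f (branch r) = branch r"
    proof cases
      \<comment> \<open>The swap would send the common neighbour of \<open>branch r\<close> and
        \<open>y\<close> to one of \<open>x\<close> and \<open>y\<close>.\<close>
      case 2
      have "(f (branch r), f (pt r b 1)) \<in> parcs H" "(f (pt r b 1), f y) \<in> parcs H"
        using D(3) in_H b1 pt_in_H[OF r(2), of 1] k_ge_2 by auto
      then show ?thesis using x_y 2 by metis
    qed
    show "f v = v"
    proof (rule rigid[OF so f _ fr _ v, of L])
      fix p u u' assume p: "p \<in> pverts G" and u: "u \<in> children r ord p" "u' \<in> children r ord p"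
        and same: "\<And>i. 0 < i \<Longrightarrow> i \<le> k \<Longrightarrow> L (pt p u i) = L (pt p u' i)"
      show "u = u'"
      proof (cases "p = r")
        case False
        \<comment> \<open>Away from the root, one of at most two neighbours is not a child.\<close>
        then have "card (children r ord p) \<le> 1"
          using card_children_less[OF so p] deg[OF p] by simp
        moreover have "finite (children r ord p)"
          using children_nbrs[OF so] finite_nbrs finite_subset by blast
        ultimately show ?thesis using u by (metis card_le_Suc0_iff_eq One_nat_def)
      next
        case True
        \<comment> \<open>At the root the two paths begin with \<open>x\<close> and
          \<open>pt r b 1\<close>, labelled 1 and 2.\<close>
        have "(branch r, pt r u 1) \<in> parcs H" "(branch r, pt r u' 1) \<in> parcs H"
          using H_arcI[of r u 0] H_arcI[of r u' 0] u True k_ge_2 by (auto simp: children_def)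
        then have "pt r u 1 \<in> {x, pt r b 1}" "pt r u' 1 \<in> {x, pt r b 1}"
          using nbr_r by (auto simp: x_def)
        moreover have "L x \<noteq> L (pt r b 1)"
        proof -
          have "count (pt r b 1) b = 1" by (simp add: count_path_point)
          then have "pt r b 1 \<notin> S" using counts by (auto simp: S_def)
          then show ?thesis by (simp add: L_def S_def)
        qed
        moreover have "L (pt r u 1) = L (pt r u' 1)" using same[of 1] True k_ge_2 by simp
        ultimately have "pt r u 1 = pt r u' 1" by (metis insertE singletonD)
        then show ?thesis using pt_1_eq_iff[of r u u'] u True by (auto simp: children_def)
      qed
    qed (use fL in blast)
  qed
  then show ?thesis by blast
qed

section \<open>Graphs with a vertex of degree at least 3\<close>

lemma ex_inj_avoiding:
  assumes "finite A" "finite B" "t \<in> B" "card A < card B"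
  shows "\<exists>f. inj_on f A \<and> f ` A \<subseteq> B - {t}"
proof -
  have "card A \<le> card (B - {t})" using assms by simp
  then show ?thesis using card_le_inj[of A "B - {t}"] assms by blast
qed

lemma ex_labeling_branching:
  assumes con: "connected (with_proj G)" and rV: "r \<in> pverts G" and deg_r: "3 \<le> card (nbrs r)"
    and max: "max_degree G \<le> s ^ k" and s: "2 \<le> s"
  shows "\<exists>L. distinguishing_labeling H s L"
proof -
  obtain ord where so: "search_order r ord" using ex_search_order[OF con rV] by blast
  let ?C = "children r ord"
  have finC: "finite (?C p)" for p
    using children_nbrs[OF so] finite_nbrs finite_subset by blast
  obtain a where a: "(r, a) \<in> parcs G"
    using deg_r by (metis (no_types, lifting) card.empty empty_Collect_eq not_numeral_le_zero)
  define T where "T = {1..k} \<rightarrow>\<^sub>E {1..s}"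
  have finT: "finite T" unfolding T_def by (intro finite_PiE) auto
  have cardT: "card T = s ^ k" by (simp add: T_def card_PiE)
  \<comment> \<open>\<open>mark c\<close> is forbidden for the children of a vertex \<open>p \<noteq> r\<close> with label \<open>c\<close>.\<close>
  define mark :: "nat \<Rightarrow> nat \<Rightarrow> nat"
    where "mark c = (\<lambda>i\<in>{1..k}. if i < k then 1 else if c = 1 then 2 else 1)" for c
  have mark_in: "mark c \<in> T" for c using s by (auto simp: mark_def T_def)
  \<comment> \<open>Words are chosen for every possible label \<open>c\<close> of \<open>p\<close>,
    since the actual label comes from the recursion below.\<close>
  have "\<exists>g. inj_on g (?C p) \<and> g ` ?C p \<subseteq> T \<and>
      (if p = r then g a = mark c else mark c \<notin> g ` ?C p)" if p: "p \<in> pverts G" for p c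
  proof (cases "p = r")
    case True
    have aC: "a \<in> ?C r" using children_root[OF so] a by simp
    have "card (?C r) \<le> s ^ k"
      using card_nbrs_le[OF rV] max by (simp add: children_root[OF so])
    \<comment> \<open>The root may have \<open>s ^ k\<close> children, so no word can be left out
      there: \<open>mark c\<close> goes to \<open>a\<close> and the others avoid it.\<close>
    then have "card (?C r - {a}) < card T"
      using card_Diff1_less[OF finC aC] by (simp add: cardT)
    then obtain g where g: "inj_on g (?C r - {a})" "g ` (?C r - {a}) \<subseteq> T - {mark c}"
      using ex_inj_avoiding[OF _ finT mark_in] finC by blast
    have "inj_on (g(a := mark c)) (?C r)"
    proof (rule inj_onI)
      fix x y assume "x \<in> ?C r" "y \<in> ?C r" "(g(a := mark c)) x = (g(a := mark c)) y"
      then show "x = y" using g by (cases "x = a"; cases "y = a") (auto simp: inj_on_def)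
    qed
    moreover have "(g(a := mark c)) ` ?C r \<subseteq> T" using g(2) mark_in by auto
    ultimately show ?thesis using True by (intro exI[of _ "g(a := mark c)"]) auto
  next
    case False
    have "card (?C p) < card T"
      using card_children_less[OF so p False] card_nbrs_le[OF p] max by (simp add: cardT)
    then obtain g where "inj_on g (?C p)" "g ` ?C p \<subseteq> T - {mark c}"
      using ex_inj_avoiding[OF finC finT mark_in] by blast
    then show ?thesis using False by (intro exI[of _ g]) auto
  qed
  then have "\<forall>p c. \<exists>g. p \<in> pverts G \<longrightarrow> inj_on g (?C p) \<and> g ` ?C p \<subseteq> T \<and>
      (if p = r then g a = mark c else mark c \<notin> g ` ?C p)" by blast
  then obtain e where e: "\<And>p c. p \<in> pverts G \<Longrightarrow> inj_on (e p c) (?C p) \<and> e p c ` ?C p \<subseteq> T \<and>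
      (if p = r then e p c a = mark c else mark c \<notin> e p c ` ?C p)" by metis
  define par where "par v = (THE p. v \<in> ?C p)" for v
  have par: "par v = p" if "v \<in> ?C p" for v p
    unfolding par_def using that children_disjoint[OF so] by blast
  \<comment> \<open>The label of \<open>v\<close> is the last letter of its word, and the choice of
    that word depends on the label of the parent.\<close>
  define c where "c = wfrec (measure ord) (\<lambda>g v. if v = r then 2 else e (par v) (g (par v)) v k)"
  have c_root: "c r = 2" unfolding c_def by (subst wfrec) auto
  have c_child: "c v = e p (c p) v k" if "v \<in> ?C p" for v p
  proof -
    have "v \<noteq> r" using that by (auto simp: children_def)
    then show ?thesis
      using par[OF that] child_later[OF so that] unfolding c_def
      by (subst wfrec) (auto simp: cut_apply)
  qed
  define t where "t v = e (par v) (c (par v)) v" for v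
  have t: "t v = e p (c p) v" if "v \<in> ?C p" for v p using par[OF that] by (simp add: t_def)
  have CV: "p \<in> pverts G" if "v \<in> ?C p" for v p
    using that in_arcsD1 by (auto simp: children_def)
  have t_in: "t v \<in> T" if "v \<in> ?C p" for v p using e[OF CV[OF that]] t[OF that] that by auto
  have t_range: "t v i \<in> {1..s}" if "v \<in> ?C p" "0 < i" "i \<le> k" for v p i
    using t_in[OF that(1)] that(2,3) by (auto simp: T_def PiE_iff)
  have t_k: "t v k = c v" if "v \<in> ?C p" for v p using c_child[OF that] t[OF that] by simp
  have c_range: "c v \<in> {1..s}" if v: "v \<in> pverts G" for v
  proof (cases "v = r")
    case False
    obtain p where p: "v \<in> ?C p" using ex_parent[OF so v False] by blast
    show ?thesis using t_range[OF p, of k] t_k[OF p] k_ge_2 by simp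
  qed (use c_root s in simp)
  \<comment> \<open>Seen from the child, the word is read backwards. An edge that joins no parent to
    a child gets 2 at all its inner points.\<close>
  define w where "w u v i = (if v \<in> ?C u then t v i else if u \<in> ?C v then t u (k - i) else 2)"
    for u v i
  have "\<exists>L. (\<forall>v. L (branch v) = c v) \<and>
    (\<forall>u v i. (u, v) \<in> parcs G \<longrightarrow> 0 < i \<longrightarrow> i < k \<longrightarrow> L (pt u v i) = w u v i)"
  proof (rule ex_labeling)
    fix u v i assume "0 < i" "i < k"
    moreover have "\<not> (u \<in> ?C v \<and> v \<in> ?C u)" using child_later[OF so] less_asym by blast
    ultimately show "w v u (k - i) = w u v i" by (auto simp: w_def)
  qed
  then obtain L where L_branch: "\<And>v. L (branch v) = c v"
    and L_inner: "\<And>u v i. (u, v) \<in> parcs G \<Longrightarrow> 0 < i \<Longrightarrow> i < k \<Longrightarrow> L (pt u v i) = w u v i"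
    by blast
  have L_child: "L (pt p v i) = t v i" if "v \<in> ?C p" "0 < i" "i \<le> k" for p v i
    using that L_inner[of p v i] L_branch[of v] t_k[OF that(1)]
    by (cases "i = k") (auto simp: w_def children_def)
  have mark_eq: "g = mark d"
    if "g \<in> T" "\<And>i. 0 < i \<Longrightarrow> i < k \<Longrightarrow> g i = 1" "g k = (if d = 1 then 2 else 1)" for g d
  proof
    fix i
    show "g i = mark d i" using that by (cases "i \<in> {1..k}") (auto simp: mark_def T_def PiE_iff extensional_def)
  qed
  have no_mark: "t v \<noteq> mark (c p)" if "v \<in> ?C p" "p \<noteq> r" for v p
    using e[OF CV[OF that(1)], of "c p"] t[OF that(1)] that by (metis imageI)
  \<comment> \<open>Suppose \<open>r'\<close> is not \<open>r\<close>. Read from parent to child,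
    the pattern is the word \<open>mark 2\<close>, forbidden below label 2. Read from child to
    parent, it is \<open>mark 1\<close>, forbidden below \<open>a'\<close>, which has label 1 and so
    is not the root. On any other edge an inner 2 contradicts it.\<close>
  have unique: "r' = r" if arc: "(r', a') \<in> parcs G" and c': "c r' = 2" "c a' = 1"
    and w1: "\<And>i. 0 < i \<Longrightarrow> i < k \<Longrightarrow> w r' a' i = 1" for r' a'
  proof (rule ccontr)
    assume nr: "r' \<noteq> r"
    consider "a' \<in> ?C r'" | "a' \<notin> ?C r'" "r' \<in> ?C a'" | "a' \<notin> ?C r'" "r' \<notin> ?C a'" by blast
    then show False
    proof cases
      case 1
      have "t a' = mark (c r')"
        using mark_eq[OF t_in[OF 1], of "c r'"] w1 1 t_k[OF 1] c' by (simp add: w_def)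
      then show False using no_mark[OF 1 nr] by simp
    next
      case 2
      have "t r' i = 1" if "0 < i" "i < k" for i
        using w1[of "k - i"] 2 that by (simp add: w_def)
      then have "t r' = mark (c a')"
        using mark_eq[OF t_in[OF 2(2)], of "c a'"] t_k[OF 2(2)] c' by simp
      moreover have "a' \<noteq> r" using c' c_root by auto
      ultimately show False using no_mark[OF 2(2)] by simp
    next
      case 3
      then show False using w1[of 1] k_ge_2 by (simp add: w_def)
    qed
  qed
  have "distinguishing_labeling H s L"
    unfolding distinguishing_labeling_def
  proof (intro conjI allI impI ballI; (elim conjE)?)
    show "L ` pverts H \<subseteq> {1..s}"
    proof clarify
      fix x assume "x \<in> pverts H"
      then show "L x \<in> {1..s}"
      proof (cases rule: H_vert_cases)
        case (inner u v i)
        then show ?thesis using L_inner s t_range[of v u i] t_range[of u v "k - i"]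
          by (auto simp: w_def)
      qed (use L_branch c_range in simp)
    qed
  next
    fix f x assume f: "automorphism H f" and fL: "\<forall>v\<in>pverts H. L (f v) = L v"
      and x: "x \<in> pverts H"
    obtain r' where r': "r' \<in> pverts G" "f (branch r) = branch r'"
      using automorphism_branch[OF f rV deg_r] .
    obtain a' where a': "(r', a') \<in> parcs G" "\<And>i. i \<le> k \<Longrightarrow> f (pt r a i) = pt r' a' i"
      using automorphism_path[OF f a r'(2)] by blast
    have Leq: "L (pt r' a' i) = L (pt r a i)" if "i \<le> k" for i
      using fL pt_in_H[OF a that] a'(2)[OF that] by metis
    have aC: "a \<in> ?C r" using children_root[OF so] a by simp
    have ta: "t a = mark 2" using t[OF aC] e[OF rV] c_root by simp
    have La: "L (pt r a i) = 1" if "0 < i" "i \<le> k" for i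
      using L_child[OF aC that] ta that by (auto simp: mark_def)
    have "r' = r"
    proof (rule unique[OF a'(1)])
      show "c r' = 2" using Leq[of 0] L_branch c_root by simp
      show "c a' = 1" using Leq[of k] La[of k] L_branch k_ge_2 by simp
      show "w r' a' i = 1" if "0 < i" "i < k" for i
        using Leq[of i] La[of i] L_inner[OF a'(1) that] that by simp
    qed
    then have fr: "f (branch r) = branch r" using r' by simp
    show "f x = x"
    proof (rule rigid[OF so f _ fr _ x, of L])
      fix p v v' assume p: "p \<in> pverts G" and v: "v \<in> ?C p" "v' \<in> ?C p"
        and same: "\<And>i. 0 < i \<Longrightarrow> i \<le> k \<Longrightarrow> L (pt p v i) = L (pt p v' i)"
      have "t v = t v'"
      proof (rule PiE_ext)
        show "t v \<in> {1..k} \<rightarrow>\<^sub>E {1..s}" "t v' \<in> {1..k} \<rightarrow>\<^sub>E {1..s}"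
          using t_in v by (auto simp: T_def)
        show "t v i = t v' i" if "i \<in> {1..k}" for i
          using same[of i] L_child[OF v(1), of i] L_child[OF v(2), of i] that by simp
      qed
      then show "v = v'" using t[OF v(1)] t[OF v(2)] e[OF p] v by (metis inj_onD)
    qed (use fL in blast)
  qed
  then show ?thesis by blast
qed

section \<open>Combination of the two cases\<close>

text \<open>If all degrees were at most 1, every other vertex would be adjacent to \<open>r\<close>:
  an earlier neighbour \<open>u\<close> of \<open>v\<close> other than \<open>r\<close> would have
  the two neighbours \<open>v\<close> and one earlier than \<open>u\<close>. Then there are at most
  two vertices.\<close>

lemma ex_two_nbrs:
  assumes con: "connected (with_proj G)" and card: "3 \<le> card (pverts G)"
  obtains r a b where "(r, a) \<in> parcs G" "(r, b) \<in> parcs G" "a \<noteq> b"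
proof -
  obtain r where r: "r \<in> pverts G" using card by fastforce
  obtain ord where so: "search_order r ord" using ex_search_order[OF con r] by blast
  have "\<exists>r a b. (r, a) \<in> parcs G \<and> (r, b) \<in> parcs G \<and> a \<noteq> b"
  proof (rule ccontr)
    assume neg: "\<nexists>r a b. (r, a) \<in> parcs G \<and> (r, b) \<in> parcs G \<and> a \<noteq> b"
    have *: "(r, v) \<in> parcs G" if v: "v \<in> pverts G" "v \<noteq> r" for v
    proof -
      obtain u where u: "(v, u) \<in> parcs G" "ord u < ord v"
        using earlier_nbr[OF so v] by blast
      have "u = r"
      proof (rule ccontr)
        assume "u \<noteq> r"
        then obtain q where "(u, q) \<in> parcs G" "ord q < ord u"
          using earlier_nbr[OF so, of u] in_arcsD2 u(1) by blast
        then show False using neg arc_rev[OF u(1)] u(2) by force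
      qed
      then show ?thesis using arc_rev u by blast
    qed
    have "card (pverts G - {r}) \<le> 1"
      using * neg by (auto simp: card_le_Suc0_iff_eq)
    then show False using card r by simp
  qed
  then show thesis using that by blast
qed

lemma ex_distinguishing_labeling:
  assumes con: "connected (with_proj G)" and card: "3 \<le> card (pverts G)"
    and max: "max_degree G \<le> s ^ k" and s: "2 \<le> s"
  shows "\<exists>L. distinguishing_labeling H s L"
proof (cases "\<exists>r\<in>pverts G. 3 \<le> card (nbrs r)")
  case True
  then show ?thesis using ex_labeling_branching con max s by blast
next
  case False
  then have "card (nbrs v) \<le> 2" if "v \<in> pverts G" for v using that by fastforce
  then show ?thesis
    using ex_two_nbrs[OF con card] ex_labeling_max_degree_2[OF con _ _ _ _ s] by metis
qed

end

theorem theorem3p8: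
  fixes G :: "'a pair_pre_digraph" and k :: nat
  assumes "pair_graph G"
    and "connected (with_proj G)"
    and "card (pverts G) \<ge> 3"
    and "k \<ge> 2"
  shows "distinguishing_number (k_subdivision k G)
    \<le> (LEAST s. s \<ge> 2 \<and> 2 ^ k + (\<Sum>j=3..s. j ^ (k - 1)) \<ge> max_degree G)"
proof -
  interpret subdivided_graph G k
    using assms by (simp add: subdivided_graph_def subdivided_graph_axioms_def)
  define s where "s = (LEAST s. s \<ge> 2 \<and> 2 ^ k + (\<Sum>j=3..s. j ^ (k - 1)) \<ge> max_degree G)"
  have s: "2 \<le> s" "max_degree G \<le> 2 ^ k + (\<Sum>j=3..s. j ^ (k - 1))"
    using LeastI_ex[OF ex_two_power_plus_sum_ge[of "max_degree G" k]] unfolding s_def by auto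
  have "max_degree G \<le> s ^ k"
    using s(2) two_power_plus_sum_le_power[OF s(1), of k] assms(4) by simp
  then have "\<exists>L. distinguishing_labeling H s L"
    using ex_distinguishing_labeling assms(2,3) s(1) by blast
  then show ?thesis
    unfolding distinguishing_number_def s_def[symmetric] by (rule Least_le)
qed

end
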